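(* Let $(N_1,m_1)\vartriangleright_E(N_2,m_2)$ and let $G$ be a well-formed TFG for this equivalence. For a marking $m_2'$ of $N_2$ let $\mathrm{Inv}(m_2')=\{c_{|N_1} : c \text{ is a total, well-defined configuration of } G \text{ with } c\equiv m_2'\}$. Then the family $\{\mathrm{Inv}(m_2') : m_2'\in R(N_2,m_2)\}$ is a partition of $R(N_1,m_1)$.
   Context: A Petri net $N=(P,T,\mathrm{Pre},\mathrm{Post})$ has a finite set of places $P$, a finite set of transitions $T$, and flow functions $\mathrm{Pre},\mathrm{Post}:T\to(P\to\mathbb{N})$. A marking is $m:P\to\mathbb{N}$; $t$ is enabled at $m$ if $m\ge\mathrm{Pre}(t)$, and firing gives $m-\mathrm{Pre}(t)+\mathrm{Post}(t)$. $R(N,m_0)$ is the set of markings reachable from $m_0$ by finite (possibly empty) firing sequences. Linear systems: $E$ is a finite collection of equations $x=y_1+\dots+y_l$, with variable set $\mathrm{fv}(E)$; solutions are non-negative integer; consistent means having a solution. For a partial map $c$ defined exactly on $v_1,\dots,v_k$, $[c]$ is the system $v_1=c(v_1),\dots,v_k=c(v_k)$; commas denote union. $E$-equivalence: $(N_1,m_1)\vartriangleright_E(N_2,m_2)$ (place sets $P_1,P_2$) iff (A1) $E,[m]$ consistent for every $m\in R(N_1,m_1)\cup R(N_2,m_2)$; (A2) $E,[m_1],[m_2]$ consistent; (A3) for all markings $m_1'$ of $N_1$, $m_2'$ of $N_2$ with $E,[m_1'],[m_2']$ consistent, $m_1'\in R(N_1,m_1)\iff m_2'\in R(N_2,m_2)$.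 TFGs: fix pairwise disjoint sets $K(n)$, $n\in\mathbb{N}$, of constant nodes of value $n$, disjoint from place/variable names; $K=\bigcup_nK(n)$. A TFG with places $P$ is $(V,R,A)$, $V=P\cup S$ with $S\subset K$ finite, $R,A\subseteq V\times V$ disjoint; $v\mathbin{\to\!\bullet} w$ iff $(v,w)\in R$, $v\mathbin{\circ\!\to} w$ iff $(v,w)\in A$, $v\to w$ for either. Roots have no incoming arc; $\circ$-leaves have no outgoing $A$-arc. $v\mathbin{\circ\!\to} X$: $X$ is the nonempty set of all $A$-successors of $v$; $X\mathbin{\to\!\bullet} v$: $X$ is the nonempty set of all $R$-predecessors of $v$. Well-formed TFG for $(N_1,m_1)\vartriangleright_E(N_2,m_2)$: (T1) $V\setminus K=P_1\cup P_2\cup\mathrm{fv}(E)$; (T2) nodes in $V\cap K$ are roots; (T3) not both $p\mathbin{\circ\!\to} q$ and $p'\to q$ with $p\ne p'$, and not both $p\mathbin{\to\!\bullet} q$ and $p\mathbin{\circ\!\to} q$; (T4) $v\mathbin{\circ\!\to} X$ or $X\mathbin{\to\!\bullet} v$ iff the equation $v=\sum_{x\in X}x$ is in $E$; (T5) acyclic; (T6) roots not in $K$ are exactly $P_2$, $\circ$-leaves not in $K$ exactly $P_1$. A configuration is a partial $c:V\to\mathbb{N}$ ($\bot$ where undefined) with $c(v)=n$ for $v\in V\cap K(n)$; total if defined everywhere; $c_{|N}$ is its restriction to the places of $N$. For a marking $m$, $c\equiv m$ means $c(p)=m(p)$ for all places $p$ where both are defined. $c$ is well-defined if (CBot) whenever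 $v\to w$, $c(v)=\bot\iff c(w)=\bot$; (CEq) whenever $c(v)\ne\bot$ and ($v\mathbin{\circ\!\to} X$ or $X\mathbin{\to\!\bullet} v$), $c(v)=\sum_{x\in X}c(x)$. *)

theory Defs
  imports "HOL-Library.Multiset" "HOL-Library.Disjoint_Sets"
begin

record ('v, 't) net =
  places :: "'v set"
  transitions :: "'t set"
  Pre :: "'t \<Rightarrow> 'v \<Rightarrow> nat"
  Post :: "'t \<Rightarrow> 'v \<Rightarrow> nat"

definition petri_net :: "('v, 't) net \<Rightarrow> bool" where
  "petri_net N \<longleftrightarrow> finite (places N) \<and> finite (transitions N)"

text \<open>Markings are partial maps defined exactly on the places, so that markings and
  configurations of token flow graphs are objects of the same type.\<close>

definition marking :: "('v, 't) net \<Rightarrow> ('v \<rightharpoonup> nat) \<Rightarrow> bool" where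
  "marking N m \<longleftrightarrow> dom m = places N"

definition enabled :: "('v, 't) net \<Rightarrow> ('v \<rightharpoonup> nat) \<Rightarrow> 't \<Rightarrow> bool" where
  "enabled N m t \<longleftrightarrow> t \<in> transitions N \<and> (\<forall>p\<in>places N. Pre N t p \<le> the (m p))"

definition fire :: "('v, 't) net \<Rightarrow> 't \<Rightarrow> ('v \<rightharpoonup> nat) \<Rightarrow> ('v \<rightharpoonup> nat)" where
  "fire N t m = (\<lambda>p. if p \<in> places N then Some (the (m p) - Pre N t p + Post N t p) else None)"

definition step :: "('v, 't) net \<Rightarrow> ('v \<rightharpoonup> nat) \<Rightarrow> ('v \<rightharpoonup> nat) \<Rightarrow> bool" where
  "step N m m' \<longleftrightarrow> (\<exists>t. enabled N m t \<and> m' = fire N t m)"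

definition reachable :: "('v, 't) net \<Rightarrow> ('v \<rightharpoonup> nat) \<Rightarrow> ('v \<rightharpoonup> nat) set" where
  "reachable N m\<^sub>0 = {m. (step N)\<^sup>*\<^sup>* m\<^sub>0 m}"

text \<open>Throughout, \<open>K n\<close> is the set of constant nodes of value \<open>n\<close>. Places, variables and constant
  nodes live in one type; disjointness is a hypothesis. Constant nodes may occur on both sides
  of an equation, and denote their value there.

  \<open>SumEq x {#y\<^sub>1, \<dots>, y\<^sub>l#}\<close> is the equation \<open>x = y\<^sub>1 + \<dots> + y\<^sub>l\<close>, where the \<open>y\<^sub>i\<close> need not be
  distinct; \<open>ValEq x k\<close> is \<open>x = k\<close>, needed for the systems \<open>[c]\<close> only.\<close>

datatype 'v equation = SumEq 'v "'v multiset" | ValEq 'v nat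

definition constants :: "(nat \<Rightarrow> 'v set) \<Rightarrow> 'v set" where
  "constants K = (\<Union>n. K n)"

definition linear_system :: "'v equation set \<Rightarrow> bool" where
  "linear_system E \<longleftrightarrow> finite E \<and> (\<forall>e\<in>E. \<exists>x M. e = SumEq x M \<and> M \<noteq> {#})"

definition fv :: "(nat \<Rightarrow> 'v set) \<Rightarrow> 'v equation set \<Rightarrow> 'v set" where
  "fv K E = (\<Union>e\<in>E. set_equation e) - constants K"

fun holds :: "('v \<Rightarrow> nat) \<Rightarrow> 'v equation \<Rightarrow> bool" where
  "holds s (SumEq x M) \<longleftrightarrow> s x = (\<Sum>y\<in>#M. s y)"
| "holds s (ValEq x k) \<longleftrightarrow> s x = k"

definition solution :: "(nat \<Rightarrow> 'v set) \<Rightarrow> 'v equation set \<Rightarrow> ('v \<Rightarrow> nat) \<Rightarrow> bool" where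
  "solution K E s \<longleftrightarrow> (\<forall>n. \<forall>v\<in>K n. s v = n) \<and> (\<forall>e\<in>E. holds s e)"

definition consistent :: "(nat \<Rightarrow> 'v set) \<Rightarrow> 'v equation set \<Rightarrow> bool" where
  "consistent K E \<longleftrightarrow> (\<exists>s. solution K E s)"

definition system_of :: "('v \<rightharpoonup> nat) \<Rightarrow> 'v equation set" where
  "system_of c = {ValEq v k | v k. c v = Some k}"

definition E_equivalent ::
  "(nat \<Rightarrow> 'v set) \<Rightarrow> 'v equation set \<Rightarrow> ('v, 't) net \<Rightarrow> ('v \<rightharpoonup> nat) \<Rightarrow>
   ('v, 'u) net \<Rightarrow> ('v \<rightharpoonup> nat) \<Rightarrow> bool" where
  "E_equivalent K E N\<^sub>1 m\<^sub>1 N\<^sub>2 m\<^sub>2 \<longleftrightarrow>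
     (\<forall>m \<in> reachable N\<^sub>1 m\<^sub>1 \<union> reachable N\<^sub>2 m\<^sub>2. consistent K (E \<union> system_of m)) \<and>
     consistent K (E \<union> system_of m\<^sub>1 \<union> system_of m\<^sub>2) \<and>
     (\<forall>m\<^sub>1' m\<^sub>2'. marking N\<^sub>1 m\<^sub>1' \<longrightarrow> marking N\<^sub>2 m\<^sub>2' \<longrightarrow>
        consistent K (E \<union> system_of m\<^sub>1' \<union> system_of m\<^sub>2') \<longrightarrow>
        (m\<^sub>1' \<in> reachable N\<^sub>1 m\<^sub>1 \<longleftrightarrow> m\<^sub>2' \<in> reachable N\<^sub>2 m\<^sub>2))"

text \<open>\<open>Red\<close> holds the arcs drawn with the dot at the target, \<open>Agg\<close> those with the circle at the source.\<close>

record 'v flow_graph =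
  nodes :: "'v set"
  Red :: "('v \<times> 'v) set"
  Agg :: "('v \<times> 'v) set"

definition tfg :: "(nat \<Rightarrow> 'v set) \<Rightarrow> 'v set \<Rightarrow> 'v flow_graph \<Rightarrow> bool" where
  "tfg K P G \<longleftrightarrow>
     P \<inter> constants K = {} \<and>
     (\<exists>S. finite S \<and> S \<subseteq> constants K \<and> nodes G = P \<union> S) \<and>
     Red G \<subseteq> nodes G \<times> nodes G \<and> Agg G \<subseteq> nodes G \<times> nodes G \<and> Red G \<inter> Agg G = {}"

definition arcs :: "'v flow_graph \<Rightarrow> ('v \<times> 'v) set" where
  "arcs G = Red G \<union> Agg G"

definition roots :: "'v flow_graph \<Rightarrow> 'v set" where
  "roots G = {v \<in> nodes G. \<forall>w. (w, v) \<notin> arcs G}"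

definition agg_leaves :: "'v flow_graph \<Rightarrow> 'v set" where
  "agg_leaves G = {v \<in> nodes G. \<forall>w. (v, w) \<notin> Agg G}"

definition agg_succs :: "'v flow_graph \<Rightarrow> 'v \<Rightarrow> 'v set \<Rightarrow> bool" where
  "agg_succs G v X \<longleftrightarrow> X = {w. (v, w) \<in> Agg G} \<and> X \<noteq> {}"

definition red_preds :: "'v flow_graph \<Rightarrow> 'v set \<Rightarrow> 'v \<Rightarrow> bool" where
  "red_preds G X v \<longleftrightarrow> X = {w. (w, v) \<in> Red G} \<and> X \<noteq> {}"

text \<open>The condition on \<open>SumEq v M \<in> E\<close> says that the equations of \<open>E\<close> are exactly those read off the graph;
  in particular no equation of \<open>E\<close> repeats a summand.\<close>

definition well_formed ::
  "(nat \<Rightarrow> 'v set) \<Rightarrow> 'v flow_graph \<Rightarrow> 'v equation set \<Rightarrow>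
   ('v, 't) net \<Rightarrow> ('v, 'u) net \<Rightarrow> bool" where
  "well_formed K G E N\<^sub>1 N\<^sub>2 \<longleftrightarrow>
     nodes G - constants K = places N\<^sub>1 \<union> places N\<^sub>2 \<union> fv K E \<and>
     nodes G \<inter> constants K \<subseteq> roots G \<and>
     (\<forall>p p' q. \<not> (p \<noteq> p' \<and> (p, q) \<in> Agg G \<and> (p', q) \<in> arcs G)) \<and>
     (\<forall>p q. \<not> ((p, q) \<in> Red G \<and> (p, q) \<in> Agg G)) \<and>
     (\<forall>v M. SumEq v M \<in> E \<longleftrightarrow> (\<exists>X. (agg_succs G v X \<or> red_preds G X v) \<and> M = mset_set X)) \<and>
     acyclic (arcs G) \<and>
     roots G - constants K = places N\<^sub>2 \<and>
     agg_leaves G - constants K = places N\<^sub>1"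

definition configuration :: "(nat \<Rightarrow> 'v set) \<Rightarrow> 'v flow_graph \<Rightarrow> ('v \<rightharpoonup> nat) \<Rightarrow> bool" where
  "configuration K G c \<longleftrightarrow> dom c \<subseteq> nodes G \<and> (\<forall>n. \<forall>v \<in> nodes G \<inter> K n. c v = Some n)"

definition total :: "'v flow_graph \<Rightarrow> ('v \<rightharpoonup> nat) \<Rightarrow> bool" where
  "total G c \<longleftrightarrow> dom c = nodes G"

definition compatible :: "('v \<rightharpoonup> nat) \<Rightarrow> ('v \<rightharpoonup> nat) \<Rightarrow> bool" where
  "compatible c m \<longleftrightarrow> (\<forall>p \<in> dom c \<inter> dom m. c p = m p)"

definition well_defined :: "'v flow_graph \<Rightarrow> ('v \<rightharpoonup> nat) \<Rightarrow> bool" where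
  "well_defined G c \<longleftrightarrow>
     (\<forall>v w. (v, w) \<in> arcs G \<longrightarrow> (c v = None \<longleftrightarrow> c w = None)) \<and>
     (\<forall>v X. c v \<noteq> None \<longrightarrow> agg_succs G v X \<or> red_preds G X v \<longrightarrow>
        c v = Some (\<Sum>x\<in>X. the (c x)))"

definition Inv ::
  "(nat \<Rightarrow> 'v set) \<Rightarrow> 'v flow_graph \<Rightarrow> ('v, 't) net \<Rightarrow> ('v \<rightharpoonup> nat) \<Rightarrow> ('v \<rightharpoonup> nat) set" where
  "Inv K G N\<^sub>1 m\<^sub>2' =
     {c |` places N\<^sub>1 | c. configuration K G c \<and> total G c \<and> well_defined G c \<and> compatible c m\<^sub>2'}"

end

theory Submission imports Defs begin

text \<open>Total well-defined configurations of \<open>G\<close> are the solutions of \<open>E\<close> restricted to the nodes, so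
  \<open>Inv m\<^sub>2'\<close> consists of the markings \<open>m\<^sub>1'\<close> of \<open>N\<^sub>1\<close> such that \<open>E, [m\<^sub>1'], [m\<^sub>2']\<close> is consistent. By
  (A1) and (A3) these sets are nonempty and cover exactly the reachable markings of \<open>N\<^sub>1\<close>. They are
  disjoint because a total well-defined configuration is determined by its values on \<open>N\<^sub>1\<close>:
  every node that is neither a constant nor a place of \<open>N\<^sub>1\<close> is the sum of its \<open>Agg\<close>-successors,
  and the graph is finite and acyclic.\<close>

section \<open>Markings as parts of solutions\<close>

lemma reachable_marking:
  assumes "marking N m\<^sub>0" "m \<in> reachable N m\<^sub>0"
  shows "marking N m"
proof -
  have "(step N)\<^sup>*\<^sup>* m\<^sub>0 m"
    using assms(2) by (simp add: reachable_def)
  then show ?thesis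
    using assms(1)
    by induction (auto simp: step_def marking_def fire_def dom_def)
qed

text \<open>The valuations solving \<open>[m]\<close> are those that extend \<open>m\<close>.
  Expressing this as an equation between partial maps matches the restrictions in
  \<open>Inv\<close>.\<close>

lemma solution_Un_system_of:
  "solution K (E \<union> system_of m) s \<longleftrightarrow> solution K E s \<and> m = (Some \<circ> s) |` dom m"
proof -
  have "ValEq v k \<in> system_of m \<longleftrightarrow> m v = Some k" for v k
    by (simp add: system_of_def)
  moreover have "\<exists>v k. e = ValEq v k" if "e \<in> system_of m" for e
    using that by (auto simp: system_of_def)
  ultimately have "(\<forall>e\<in>system_of m. holds s e) \<longleftrightarrow> (\<forall>v k. m v = Some k \<longrightarrow> s v = k)"
    by (metis holds.simps(2))
  also have "\<dots> \<longleftrightarrow> (\<forall>v. m v = ((Some \<circ> s) |` dom m) v)"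
  proof (intro all_cong1)
    show "(\<forall>k. m v = Some k \<longrightarrow> s v = k) \<longleftrightarrow> m v = ((Some \<circ> s) |` dom m) v" for v
      by (cases "m v") (auto simp: restrict_map_def dom_def)
  qed
  also have "\<dots> \<longleftrightarrow> m = (Some \<circ> s) |` dom m"
    by (rule fun_eq_iff[symmetric])
  finally show ?thesis
    unfolding solution_def by blast
qed

text \<open>Supplies the missing partner: from a solution that extends a marking of one net, a
  marking of the other net consistent with it is read off.\<close>

lemma solution_Un_system_of_restrict:
  "solution K E s \<Longrightarrow> solution K (E \<union> system_of ((Some \<circ> s) |` A)) s"
  by (auto simp: solution_def system_of_def restrict_map_def split: if_splits)

section \<open>Finiteness and well-foundedness of the graph\<close>

lemma finite_nodes:
  assumes "linear_system E" "petri_net N\<^sub>1" "petri_net N\<^sub>2" "tfg K P G" "well_formed K G E N\<^sub>1 N\<^sub>2"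
  shows "finite (nodes G)"
proof -
  have "finite (set_equation e)" if "e \<in> E" for e
    using assms(1) that by (auto simp: linear_system_def)
  then have "finite (fv K E)"
    using assms(1) by (auto simp: fv_def linear_system_def)
  then have "finite (nodes G - constants K)"
    using assms(2,3,5) by (simp add: well_formed_def petri_net_def)
  \<comment> \<open>The nodes are \<open>P \<union> S\<close> with \<open>S\<close> finite, and
    \<open>P\<close> contains no constants, so only members of \<open>S\<close> remain.\<close>
  moreover have "finite (nodes G \<inter> constants K)"
    using assms(4) by (auto simp: tfg_def Int_Un_distrib2)
  ultimately show ?thesis
    by (metis Int_Diff_Un finite_Un)
qed

text \<open>The converse is taken so that induction at a node may assume the claim for its
  successors.\<close>

lemma finite_acyclic_arcs_wf:
  assumes "finite (nodes G)" "tfg K P G" "acyclic (arcs G)"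
  shows "wf ((arcs G)\<inverse>)"
proof -
  have "arcs G \<subseteq> nodes G \<times> nodes G"
    using assms(2) by (auto simp: tfg_def arcs_def)
  then have "finite (arcs G)"
    using assms(1) by (meson finite_SigmaI finite_subset)
  then show ?thesis
    using assms(3) by (rule finite_acyclic_wf_converse)
qed

section \<open>Configurations and solutions\<close>

lemma SumEq_iff_graph:
  assumes "well_formed K G E N\<^sub>1 N\<^sub>2"
  shows "SumEq v M \<in> E \<longleftrightarrow> (\<exists>X. (agg_succs G v X \<or> red_preds G X v) \<and> M = mset_set X)"
  using assms unfolding well_formed_def by blast

lemma graph_equation_nodes:
  assumes "tfg K P G" "agg_succs G v X \<or> red_preds G X v"
  shows "v \<in> nodes G" "X \<subseteq> nodes G"
  using assms by (auto simp: tfg_def agg_succs_def red_preds_def)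

text \<open>By (T4) every sum read off the graph is an equation of \<open>E\<close>. (CBot) holds
  because arcs join nodes only and \<open>c\<close> is defined on all nodes.\<close>

lemma configuration_of_solution:
  assumes "tfg K P G" "well_formed K G E N\<^sub>1 N\<^sub>2" "solution K E s"
  defines "c \<equiv> (Some \<circ> s) |` nodes G"
  shows "configuration K G c" "total G c" "well_defined G c"
proof -
  show "configuration K G c"
    using assms(3) by (auto simp: configuration_def c_def solution_def)
  show "total G c"
    by (auto simp: total_def c_def)
  have "arcs G \<subseteq> nodes G \<times> nodes G"
    using assms(1) by (auto simp: tfg_def arcs_def)
  moreover have "c v = Some (\<Sum>x\<in>X. the (c x))" if X: "agg_succs G v X \<or> red_preds G X v" for v X
  proof -
    have "SumEq v (mset_set X) \<in> E"
      using SumEq_iff_graph[OF assms(2)] X by blast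
    then have "s v = (\<Sum>x\<in>X. s x)"
      using assms(3) by (auto simp: solution_def sum_unfold_sum_mset)
    also have "\<dots> = (\<Sum>x\<in>X. the (c x))"
      using graph_equation_nodes(2)[OF assms(1) X] by (intro sum.cong) (auto simp: c_def)
    finally show ?thesis
      using graph_equation_nodes(1)[OF assms(1) X] by (simp add: c_def)
  qed
  moreover have "c v = None \<longleftrightarrow> v \<notin> nodes G" for v
    by (simp add: c_def restrict_map_def)
  ultimately show "well_defined G c"
    unfolding well_defined_def by blast
qed

lemma solution_of_configuration:
  assumes "disjoint_family K" "linear_system E" "tfg K P G" "well_formed K G E N\<^sub>1 N\<^sub>2"
    and "configuration K G c" "total G c" "well_defined G c"
  obtains s where "solution K E s" "c = (Some \<circ> s) |` nodes G"
proof
  \<comment> \<open>Off the graph no equation of \<open>E\<close> constrains the value, but a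
    solution must still give every constant its value, which is unique as \<open>K\<close> is
    disjoint. Any other name outside the graph gets an arbitrary number.\<close>
  let ?s = "\<lambda>v. if v \<in> nodes G then the (c v) else (THE n. v \<in> K n)"
  have dom: "c v \<noteq> None \<longleftrightarrow> v \<in> nodes G" for v
    using assms(6) by (auto simp: total_def)
  show "c = (Some \<circ> ?s) |` nodes G"
  proof
    fix v
    show "c v = ((Some \<circ> ?s) |` nodes G) v"
      using dom[of v] by (cases "v \<in> nodes G") auto
  qed
  have const: "?s v = n" if "v \<in> K n" for v n
  proof -
    have "(THE n. v \<in> K n) = n"
      using that assms(1) by (intro the_equality) (auto simp: disjoint_family_on_def)
    moreover have "c v = Some n" if "v \<in> nodes G"
      using that \<open>v \<in> K n\<close> assms(5) unfolding configuration_def by blast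
    ultimately show ?thesis
      by simp
  qed
  have "holds ?s e" if in_E: "e \<in> E" for e
  proof -
    obtain v M where e: "e = SumEq v M"
      using in_E assms(2) unfolding linear_system_def by blast
    then obtain X where X: "agg_succs G v X \<or> red_preds G X v" "M = mset_set X"
      using in_E SumEq_iff_graph[OF assms(4)] by blast
    note sub = graph_equation_nodes[OF assms(3) X(1)]
    then have "c v = Some (\<Sum>x\<in>X. the (c x))"
      using assms(7) dom[of v] X(1) unfolding well_defined_def by metis
    moreover have "(\<Sum>x\<in>X. the (c x)) = (\<Sum>x\<in>X. ?s x)"
      using sub by (intro sum.cong) auto
    ultimately have "?s v = (\<Sum>x\<in>X. ?s x)"
      using sub by simp
    then show ?thesis
      by (simp only: e X(2) holds.simps sum_unfold_sum_mset)
  qed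
  with const show "solution K E ?s"
    unfolding solution_def by blast
qed

lemma Inv_iff_consistent:
  assumes "disjoint_family K" "linear_system E" "tfg K P G" "well_formed K G E N\<^sub>1 N\<^sub>2"
    and "marking N\<^sub>2 m\<^sub>2"
  shows "m \<in> Inv K G N\<^sub>1 m\<^sub>2 \<longleftrightarrow> marking N\<^sub>1 m \<and> consistent K (E \<union> system_of m \<union> system_of m\<^sub>2)"
proof -
  have nodes: "places N\<^sub>1 \<subseteq> nodes G" "dom m\<^sub>2 \<subseteq> nodes G"
    using assms(4,5) by (auto simp: well_formed_def marking_def)
  have compat: "compatible ((Some \<circ> s) |` nodes G) m\<^sub>2 \<longleftrightarrow> m\<^sub>2 = (Some \<circ> s) |` dom m\<^sub>2" for s
    using nodes(2) by (force simp: compatible_def fun_eq_iff restrict_map_def)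
  have restrict: "((Some \<circ> s) |` nodes G) |` places N\<^sub>1 = (Some \<circ> s) |` places N\<^sub>1" for s :: "'a \<Rightarrow> nat"
    using nodes(1) by (simp add: Int_absorb1 Int_absorb2)
  \<comment> \<open>One valuation \<open>s\<close> carries all the data: its restriction to the
    nodes is the configuration, and its restrictions to the two place sets are the markings.\<close>
  have "m \<in> Inv K G N\<^sub>1 m\<^sub>2 \<longleftrightarrow>
      (\<exists>s. solution K E s \<and> m = (Some \<circ> s) |` places N\<^sub>1 \<and> m\<^sub>2 = (Some \<circ> s) |` dom m\<^sub>2)" (is "?L \<longleftrightarrow> ?R")
  proof
    assume ?L
    then obtain c where c: "m = c |` places N\<^sub>1" "configuration K G c" "total G c" "well_defined G c"
        "compatible c m\<^sub>2"
      by (auto simp: Inv_def)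
    obtain s where s: "solution K E s" "c = (Some \<circ> s) |` nodes G"
      using solution_of_configuration[OF assms(1-4) c(2-4)] .
    then have "m = (Some \<circ> s) |` places N\<^sub>1" "m\<^sub>2 = (Some \<circ> s) |` dom m\<^sub>2"
      using c(1,5) compat restrict by blast+
    with s(1) show ?R
      by blast
  next
    assume ?R
    then obtain s where s: "solution K E s" "m = (Some \<circ> s) |` places N\<^sub>1" "m\<^sub>2 = (Some \<circ> s) |` dom m\<^sub>2"
      by blast
    have "m = ((Some \<circ> s) |` nodes G) |` places N\<^sub>1"
      unfolding restrict by (fact s(2))
    moreover have "compatible ((Some \<circ> s) |` nodes G) m\<^sub>2"
      unfolding compat by (fact s(3))
    ultimately show ?L
      using configuration_of_solution[OF assms(3,4) s(1)] unfolding Inv_def by blast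
  qed
  also have "\<dots> \<longleftrightarrow> marking N\<^sub>1 m \<and> consistent K (E \<union> system_of m \<union> system_of m\<^sub>2)"
  proof -
    \<comment> \<open>Separates the part independent of \<open>s\<close>, which is
      \<open>marking N\<^sub>1 m\<close>, from the statement that \<open>s\<close> extends
      \<open>m\<close>.\<close>
    have iff: "m = (Some \<circ> s) |` places N\<^sub>1 \<longleftrightarrow> dom m = places N\<^sub>1 \<and> m = (Some \<circ> s) |` dom m" for s
    proof
      assume m: "m = (Some \<circ> s) |` places N\<^sub>1"
      then have "dom m = places N\<^sub>1"
        by auto
      with m show "dom m = places N\<^sub>1 \<and> m = (Some \<circ> s) |` dom m"
        by (simp only:)
    next
      assume m: "dom m = places N\<^sub>1 \<and> m = (Some \<circ> s) |` dom m"
      from conjunct2[OF m] show "m = (Some \<circ> s) |` places N\<^sub>1"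
        unfolding conjunct1[OF m] .
    qed
    show ?thesis
      unfolding consistent_def solution_Un_system_of marking_def iff by iprover
  qed
  finally show ?thesis .
qed

section \<open>Disjointness of the classes\<close>

lemma configuration_determined:
  assumes "wf ((arcs G)\<inverse>)" "well_formed K G E N\<^sub>1 N\<^sub>2"
    and c: "configuration K G c" "total G c" "well_defined G c"
    and d: "configuration K G d" "total G d" "well_defined G d"
    and eq: "c |` places N\<^sub>1 = d |` places N\<^sub>1"
  shows "c = d"
proof
  fix v
  show "c v = d v"
    using assms(1)
  proof (induction v rule: wf_induct_rule)
    case (less v)
    have "agg_leaves G - constants K = places N\<^sub>1"
      using assms(2) by (simp add: well_formed_def)
    \<comment> \<open>Exhaustive by (T6): an \<open>Agg\<close>-leaf that is not a constant is a
      place of \<open>N\<^sub>1\<close>.\<close>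
    then consider "v \<notin> nodes G" | "v \<in> nodes G \<inter> constants K" | "v \<in> places N\<^sub>1"
      | "v \<in> nodes G" "v \<notin> agg_leaves G"
      by blast
    then show ?case
    proof cases
      case 1
      then show ?thesis
        using c(2) d(2) by (metis total_def domIff)
    next
      case 2
      then show ?thesis
        using c(1) d(1) by (auto simp: configuration_def constants_def)
    next
      case 3
      then show ?thesis
        using eq by (metis restrict_in)
    next
      case 4
      define X where "X = {w. (v, w) \<in> Agg G}"
      have X: "agg_succs G v X"
        using 4 by (auto simp: agg_leaves_def agg_succs_def X_def)
      have "c x = d x" if "x \<in> X" for x
        using that less by (auto simp: X_def arcs_def)
      then have "(\<Sum>x\<in>X. the (c x)) = (\<Sum>x\<in>X. the (d x))"
        by simp
      moreover have "c v \<noteq> None" "d v \<noteq> None"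
        using 4(1) c(2) d(2) by (auto simp: total_def)
      ultimately show ?thesis
        using X c(3) d(3) unfolding well_defined_def by metis
    qed
  qed
qed

text \<open>A common element forces a common configuration, and this one is total, so it fixes the
  value at every place of \<open>N\<^sub>2\<close>.\<close>

lemma Inv_inter_eq:
  assumes "wf ((arcs G)\<inverse>)" "well_formed K G E N\<^sub>1 N\<^sub>2" "marking N\<^sub>2 m" "marking N\<^sub>2 m'"
    and "x \<in> Inv K G N\<^sub>1 m" "x \<in> Inv K G N\<^sub>1 m'"
  shows "m = m'"
proof -
  obtain c where c: "x = c |` places N\<^sub>1" "configuration K G c" "total G c" "well_defined G c"
      "compatible c m"
    using assms(5) by (auto simp: Inv_def)
  obtain d where d: "x = d |` places N\<^sub>1" "configuration K G d" "total G d" "well_defined G d"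
      "compatible d m'"
    using assms(6) by (auto simp: Inv_def)
  have "c = d"
    using configuration_determined[OF assms(1,2) c(2-4) d(2-4)] c(1) d(1) by simp
  moreover have "places N\<^sub>2 \<subseteq> nodes G"
    using assms(2) by (auto simp: well_formed_def)
  ultimately have "\<forall>p\<in>places N\<^sub>2. m p = m' p"
    using assms(3,4) c(3,5) d(5) by (fastforce simp: compatible_def total_def marking_def)
  then show ?thesis
    using assms(3,4) by (metis domIff ext marking_def)
qed

text \<open>\<open>partition_on\<close> sees only the set of classes, in which equal classes of
  different markings would merge. The second conjunct, about the indexed family, excludes this since
  classes are nonempty.\<close>

theorem theorem3:
  fixes K :: "nat \<Rightarrow> 'v set"
    and N\<^sub>1 :: "('v, 't) net" and N\<^sub>2 :: "('v, 'u) net"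
    and m\<^sub>1 m\<^sub>2 :: "'v \<rightharpoonup> nat"
    and E :: "'v equation set" and P :: "'v set" and G :: "'v flow_graph"
  assumes "disjoint_family K"
    and "petri_net N\<^sub>1" and "marking N\<^sub>1 m\<^sub>1" and "places N\<^sub>1 \<inter> constants K = {}"
    and "petri_net N\<^sub>2" and "marking N\<^sub>2 m\<^sub>2" and "places N\<^sub>2 \<inter> constants K = {}"
    and "linear_system E"
    and "E_equivalent K E N\<^sub>1 m\<^sub>1 N\<^sub>2 m\<^sub>2"
    and "tfg K P G" and "well_formed K G E N\<^sub>1 N\<^sub>2"
  shows "partition_on (reachable N\<^sub>1 m\<^sub>1) (Inv K G N\<^sub>1 ` reachable N\<^sub>2 m\<^sub>2) \<and>
         disjoint_family_on (Inv K G N\<^sub>1) (reachable N\<^sub>2 m\<^sub>2)"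
proof -
  have equiv: "x \<in> reachable N\<^sub>1 m\<^sub>1 \<longleftrightarrow> y \<in> reachable N\<^sub>2 m\<^sub>2"
    if "marking N\<^sub>1 x" "marking N\<^sub>2 y" "consistent K (E \<union> system_of x \<union> system_of y)" for x y
    using assms(9) that unfolding E_equivalent_def by blast
  have consistent: "consistent K (E \<union> system_of m)"
    if "m \<in> reachable N\<^sub>1 m\<^sub>1 \<union> reachable N\<^sub>2 m\<^sub>2" for m
    using assms(9) that unfolding E_equivalent_def by blast
  note marking1 = reachable_marking[OF assms(3)] and marking2 = reachable_marking[OF assms(6)]
  note Inv_iff = Inv_iff_consistent[OF assms(1,8,10,11)]
  have nonempty: "Inv K G N\<^sub>1 m \<noteq> {}" if m: "m \<in> reachable N\<^sub>2 m\<^sub>2" for m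
  proof -
    obtain s where s: "solution K (E \<union> system_of m) s"
      using consistent m unfolding consistent_def by blast
    \<comment> \<open>(A1) provides \<open>s\<close>; being a solution that extends
      \<open>m\<close>, it makes \<open>x\<close> an element of the class of
      \<open>m\<close>.\<close>
    define x where "x = (Some \<circ> s) |` places N\<^sub>1"
    have "marking N\<^sub>1 x"
      by (auto simp: x_def marking_def)
    moreover have "consistent K (E \<union> system_of m \<union> system_of x)"
      unfolding consistent_def x_def using solution_Un_system_of_restrict[OF s] by blast
    then have "consistent K (E \<union> system_of x \<union> system_of m)"
      by (simp only: Un_ac)
    ultimately show ?thesis
      using Inv_iff[OF marking2[OF m]] by blast
  qed
  have Union: "(\<Union>m\<in>reachable N\<^sub>2 m\<^sub>2. Inv K G N\<^sub>1 m) = reachable N\<^sub>1 m\<^sub>1"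
  proof (intro equalityI subsetI)
    fix x
    assume "x \<in> (\<Union>m\<in>reachable N\<^sub>2 m\<^sub>2. Inv K G N\<^sub>1 m)"
    then show "x \<in> reachable N\<^sub>1 m\<^sub>1"
      using Inv_iff marking2 equiv by blast
  next
    fix x
    assume x: "x \<in> reachable N\<^sub>1 m\<^sub>1"
    obtain s where s: "solution K (E \<union> system_of x) s"
      using consistent x unfolding consistent_def by blast
    \<comment> \<open>The index of the class containing \<open>x\<close>. It is reachable by (A3),
      as \<open>x\<close> is reachable and \<open>s\<close> extends both markings.\<close>
    define m where "m = (Some \<circ> s) |` places N\<^sub>2"
    have m: "marking N\<^sub>2 m"
      by (auto simp: m_def marking_def)
    have "consistent K (E \<union> system_of x \<union> system_of m)"
      unfolding consistent_def m_def using solution_Un_system_of_restrict[OF s] by blast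
    then show "x \<in> (\<Union>m\<in>reachable N\<^sub>2 m\<^sub>2. Inv K G N\<^sub>1 m)"
      using Inv_iff[OF m] equiv[OF marking1[OF x] m] marking1[OF x] x by blast
  qed
  have "acyclic (arcs G)"
    using assms(11) by (simp add: well_formed_def)
  then have "wf ((arcs G)\<inverse>)"
    using finite_acyclic_arcs_wf finite_nodes assms(2,5,8,10,11) by blast
  then have disj: "disjoint_family_on (Inv K G N\<^sub>1) (reachable N\<^sub>2 m\<^sub>2)"
    unfolding disjoint_family_on_def using Inv_inter_eq[OF _ assms(11)] marking2 by blast
  then have "disjoint (Inv K G N\<^sub>1 ` reachable N\<^sub>2 m\<^sub>2)"
    by (rule disjoint_family_on_disjoint_image)
  then show ?thesis
    using nonempty Union disj by (auto simp: partition_on_def)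
qed

end
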